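(* Let the spatial discretisation use $N_x$ coefficients and compare a single global space-time solve on $[0,T]$, with unknown count $N_g=N_t(T)N_x$, with a uniform blocked solve having one-block unknown count $N_b=N_t^{(b)}N_x$. Let $M_g$ and $M_b$ denote the corresponding global and one-block resident-memory counts, measured in retained floating-point scalars. With $R=N_g/N_b$, the ratio $M_g/M_b$ has the following model scalings: (i) $M_g/M_b\sim R$ when only coefficient and linear work-array memory are counted; (ii) $M_g/M_b\sim R$ when a reusable retained factorisation has fixed bandwidth $p$; (iii) $M_g/M_b\sim R^2$ when a dense retained factorisation dominates the memory count.
   Context: $N_t(T)$ and $N_t^{(b)}$ are the numbers of time coefficients used by the global solve and by one block of the blocked solve. The blocked solve divides $[0,T]$ into uniform time blocks, solves them one after another, and overwrites each block, passing only the final-slice spatial coefficients (which overwrite the initial-data vector) to the next block. Resident memory means the retained solve state: the spectral coefficients, the passed interface data, work arrays such as right-hand sides, and the retained factorisation used by the linear solver. In the model, a solve with $N$ unknowns has a coefficient/work-array memory part that is linear in $N$ (proportional to $N$ with the same constant for the global and block solves, up to fixed-size lower-order arrays), plus a factor memory $S(N)$: $S(N)$ is omitted in case (i); $S(N)\sim pN$ with bandwidth $p$ independent of $N$ in case (ii); and $S(N)\sim N^2$ in case (iii), where "dominates" means the quadratic term dominates the linear part for both solves. The symbol $\sim$ denotes agreement at leading order, i.e. after discarding lower-order contributions. *)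

theory Defs
  imports Complex_Main "HOL-Library.Landau_Symbols"
begin

text \<open>
  All memory is counted in floating-point scalars. The retained factorisation is not a field of the
  state: it is a function \<open>S\<close> of the unknown count, supplied separately, so that a single state can
  be costed with different linear solvers.
\<close>

record solve_state =
  coefficients :: nat
  interface_data :: nat \<comment> \<open>the initial-data vector; in the blocked solve it is overwritten by the
    final-slice spatial coefficients passed from the previous block\<close>
  work_arrays :: nat

definition linear_memory :: "solve_state \<Rightarrow> nat" where
  "linear_memory m = coefficients m + interface_data m + work_arrays m"

definition resident_memory :: "(nat \<Rightarrow> nat) \<Rightarrow> nat \<Rightarrow> solve_state \<Rightarrow> nat" where
  "resident_memory S N m = linear_memory m + S N"

text \<open>
  The linear part is \<open>c * N\<close> up to lower-order arrays. Arrays of fixed size are covered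
  whenever \<open>N\<close> tends to infinity along \<open>F\<close>.
\<close>

definition linear_memory_model ::
  "'i filter \<Rightarrow> real \<Rightarrow> ('i \<Rightarrow> nat) \<Rightarrow> ('i \<Rightarrow> solve_state) \<Rightarrow> bool" where
  "linear_memory_model F c N m \<longleftrightarrow>
     (\<lambda>i. real (linear_memory (m i)) - c * real (N i)) \<in> o[F](\<lambda>i. real (N i))"

text \<open>The factor memory has leading-order size \<open>f N\<close> along \<open>F\<close>.\<close>

definition factor_memory_model ::
  "'i filter \<Rightarrow> (nat \<Rightarrow> nat) \<Rightarrow> (nat \<Rightarrow> nat) \<Rightarrow> ('i \<Rightarrow> nat) \<Rightarrow> bool" where
  "factor_memory_model F S f N \<longleftrightarrow> (\<lambda>i. real (S (N i))) \<sim>[F] (\<lambda>i. real (f (N i)))"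

definition quadratic_dominates ::
  "'i filter \<Rightarrow> ('i \<Rightarrow> nat) \<Rightarrow> ('i \<Rightarrow> solve_state) \<Rightarrow> bool" where
  "quadratic_dominates F N m \<longleftrightarrow>
     (\<lambda>i. real (linear_memory (m i))) \<in> o[F](\<lambda>i. real (N i) ^ 2)"

end

theory Submission imports Defs
begin

text \<open>Asymptotic equivalence is preserved by quotients, so it suffices to find the leading
  term of the memory of a single solve with \<open>N\<close> unknowns and to divide the global one
  by the block one. If the factor memory is \<open>p * N\<close> to leading order, the total is
  equivalent to \<open>(c + p) * N\<close> (\<open>resident_memory_asymp_linear\<close>); both
  solves share the constant \<open>c + p\<close>, which cancels and leaves \<open>R\<close>. If a
  quadratic factor memory dominates, the total is equivalent to \<open>N ^ 2\<close>
  (\<open>resident_memory_asymp_quadratic\<close>), and the quotient is \<open>R ^ 2\<close>. The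
  count without a factorisation is the banded one with \<open>p = 0\<close>.\<close>

lemma asymp_equiv_divide_const_mult:
  fixes f g u v :: "'i \<Rightarrow> real"
  assumes "f \<sim>[F] (\<lambda>i. k * u i)" and "g \<sim>[F] (\<lambda>i. k * v i)" and "k \<noteq> 0"
  shows "(\<lambda>i. f i / g i) \<sim>[F] (\<lambda>i. u i / v i)"
  using asymp_equiv_divide[OF assms(1,2)] assms(3) by simp

text \<open>The deviations of the linear part from \<open>c * N\<close> and of the factor from
  \<open>p * N\<close> are both o(N), hence so is their sum. Since \<open>c > 0\<close>, the
  constant \<open>c + p\<close> is nonzero even for \<open>p = 0\<close>, so o(N) is the same as
  o((c + p) N).\<close>

lemma resident_memory_asymp_linear:
  assumes lin: "linear_memory_model F c N m" and "c > 0"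
    and fac: "factor_memory_model F S (\<lambda>N. p * N) N"
  shows "(\<lambda>i. real (resident_memory S (N i) (m i))) \<sim>[F] (\<lambda>i. (c + real p) * real (N i))"
proof (rule smallo_imp_asymp_equiv)
  have "(\<lambda>i. real (S (N i)) - real p * real (N i)) \<in> o[F](\<lambda>i. real p * real (N i))"
    using asymp_equiv_imp_diff_smallo[OF fac[unfolded factor_memory_model_def]] by simp
  \<comment> \<open>An upper bound is enough here, and unlike a two-sided bound it holds for
    \<open>p = 0\<close> as well.\<close>
  also have "(\<lambda>i. real p * real (N i)) \<in> O[F](\<lambda>i. real (N i))"
    by simp
  finally have "(\<lambda>i. real (S (N i)) - real p * real (N i)) \<in> o[F](\<lambda>i. real (N i))" .
  with lin have "(\<lambda>i. (real (linear_memory (m i)) - c * real (N i))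
      + (real (S (N i)) - real p * real (N i))) \<in> o[F](\<lambda>i. real (N i))"
    unfolding linear_memory_model_def by (rule sum_in_smallo)
  also have "(\<lambda>i. (real (linear_memory (m i)) - c * real (N i)) + (real (S (N i)) - real p * real (N i)))
      = (\<lambda>i. real (resident_memory S (N i) (m i)) - (c + real p) * real (N i))"
    by (simp add: resident_memory_def algebra_simps)
  finally show "(\<lambda>i. real (resident_memory S (N i) (m i)) - (c + real p) * real (N i))
      \<in> o[F](\<lambda>i. (c + real p) * real (N i))"
    using \<open>c > 0\<close> by simp
qed

text \<open>Dominance makes the linear part o(N^2), so adding it to the factor memory does not
  change the leading term.\<close>

lemma resident_memory_asymp_quadratic:
  assumes "factor_memory_model F S (\<lambda>N. N ^ 2) N" and "quadratic_dominates F N m"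
  shows "(\<lambda>i. real (resident_memory S (N i) (m i))) \<sim>[F] (\<lambda>i. real (N i) ^ 2)"
proof -
  have "(\<lambda>i. real (S (N i)) + real (linear_memory (m i))) \<sim>[F] (\<lambda>i. real (N i) ^ 2)"
    using assms unfolding factor_memory_model_def quadratic_dominates_def
    by (subst asymp_equiv_add_right) simp_all
  then show ?thesis
    by (simp add: resident_memory_def add.commute)
qed

theorem lemma4p2:
  fixes F :: "'i filter"
    and N\<^sub>x N\<^sub>t N\<^sub>t\<^sub>b N\<^sub>g N\<^sub>b :: "'i \<Rightarrow> nat"
    and global block :: "'i \<Rightarrow> solve_state"
    and R :: "'i \<Rightarrow> real"
    and c :: real
  assumes "\<And>i. N\<^sub>x i > 0" and "\<And>i. N\<^sub>t i > 0" and "\<And>i. N\<^sub>t\<^sub>b i > 0"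
    and "\<And>i. N\<^sub>g i = N\<^sub>t i * N\<^sub>x i"
    and "\<And>i. N\<^sub>b i = N\<^sub>t\<^sub>b i * N\<^sub>x i"
    and "\<And>i. R i = real (N\<^sub>g i) / real (N\<^sub>b i)"
    and "\<And>i. coefficients (global i) = N\<^sub>g i"
    and "\<And>i. coefficients (block i) = N\<^sub>b i"
    and "\<And>i. interface_data (block i) = N\<^sub>x i"
    and "c > 0"
    and "linear_memory_model F c N\<^sub>g global"
    and "linear_memory_model F c N\<^sub>b block"
  defines "M\<^sub>g \<equiv> \<lambda>S i. real (resident_memory S (N\<^sub>g i) (global i))"
    and "M\<^sub>b \<equiv> \<lambda>S i. real (resident_memory S (N\<^sub>b i) (block i))"
  shows "((\<lambda>i. M\<^sub>g (\<lambda>_. 0) i / M\<^sub>b (\<lambda>_. 0) i) \<sim>[F] R)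
    \<and> (\<forall>S (p::nat).
          factor_memory_model F S (\<lambda>N. p * N) N\<^sub>g \<and> factor_memory_model F S (\<lambda>N. p * N) N\<^sub>b \<longrightarrow>
          ((\<lambda>i. M\<^sub>g S i / M\<^sub>b S i) \<sim>[F] R))
    \<and> (\<forall>S.
          factor_memory_model F S (\<lambda>N. N ^ 2) N\<^sub>g \<and> factor_memory_model F S (\<lambda>N. N ^ 2) N\<^sub>b \<and>
          quadratic_dominates F N\<^sub>g global \<and> quadratic_dominates F N\<^sub>b block \<longrightarrow>
          ((\<lambda>i. M\<^sub>g S i / M\<^sub>b S i) \<sim>[F] (\<lambda>i. R i ^ 2)))"
proof (intro conjI allI impI)
  have banded: "(\<lambda>i. M\<^sub>g S i / M\<^sub>b S i) \<sim>[F] R"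
    if "factor_memory_model F S (\<lambda>N. p * N) N\<^sub>g" and "factor_memory_model F S (\<lambda>N. p * N) N\<^sub>b"
    for S and p :: nat
  proof -
    have "(\<lambda>i. M\<^sub>g S i / M\<^sub>b S i) \<sim>[F] (\<lambda>i. real (N\<^sub>g i) / real (N\<^sub>b i))"
      unfolding M\<^sub>g_def M\<^sub>b_def
      \<comment> \<open>One \<open>k\<close> serves both solves because they have the same
        \<open>c\<close> per unknown and the same bandwidth \<open>p\<close>.\<close>
      by (rule asymp_equiv_divide_const_mult[where k = "c + real p"])
         (use that assms(10-12) in \<open>auto intro: resident_memory_asymp_linear\<close>)
    then show ?thesis
      unfolding assms(6)[symmetric] .
  qed
  show "(\<lambda>i. M\<^sub>g (\<lambda>_. 0) i / M\<^sub>b (\<lambda>_. 0) i) \<sim>[F] R"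
    \<comment> \<open>The zero factor fits the banded model with \<open>p = 0\<close>, as the zero
      function is asymptotically equivalent to itself.\<close>
    by (rule banded[where p = 0]) (simp_all add: factor_memory_model_def)
  show "(\<lambda>i. M\<^sub>g S i / M\<^sub>b S i) \<sim>[F] R"
    if "factor_memory_model F S (\<lambda>N. p * N) N\<^sub>g \<and> factor_memory_model F S (\<lambda>N. p * N) N\<^sub>b"
    for S and p :: nat
    using that banded by blast
  show "(\<lambda>i. M\<^sub>g S i / M\<^sub>b S i) \<sim>[F] (\<lambda>i. R i ^ 2)"
    if "factor_memory_model F S (\<lambda>N. N ^ 2) N\<^sub>g \<and> factor_memory_model F S (\<lambda>N. N ^ 2) N\<^sub>b \<and>
      quadratic_dominates F N\<^sub>g global \<and> quadratic_dominates F N\<^sub>b block" for S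
    \<comment> \<open>\<open>power_divide\<close> turns \<open>R i ^ 2\<close> into a quotient of
      squares, matching the two leading terms, whose coefficient is 1.\<close>
    using that unfolding M\<^sub>g_def M\<^sub>b_def assms(6) power_divide
    by (intro asymp_equiv_divide resident_memory_asymp_quadratic) simp_all
qed

end
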